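(* Let $c\in(0,\infty)$, let $\alpha:=1+\frac c2-\frac{\sqrt{4c+c^2}}{2}$, and assign to the edges of the zigzag ladder graph $G^{H_2}$ the weights $c$ to each $z_m$ and $1$ to each $h_m$. Then for $n\ge2$ the weighted number of spanning trees of $G^{H_2}_{0,n-1}$ is $$\sum_t\ \prod_{e\in t}\mathrm{weight}(e)=\frac{1-\alpha}{1+\alpha}\big(\alpha^{1-n}-\alpha^{n-1}\big),$$ where the sum is over all spanning trees $t$ of $G^{H_2}_{0,n-1}$. In particular (case $c=1$), the number of spanning trees of $G^{H_2}_{0,n-1}$ is $$\frac{1}{\sqrt5}\left(\Big(\frac{3+\sqrt5}{2}\Big)^{n-1}-\Big(\frac{3-\sqrt5}{2}\Big)^{n-1}\right).$$
   Context: The zigzag ladder graph (helix-2-graph) $G^{H_2}$ has vertex set $\mathbb{Z}$ and edges $z_m=\{m-1,m\}$ and $h_m=\{m-2,m\}$ for $m\in\mathbb{Z}$. $G^{H_2}_{m,n}$ is the subgraph induced by $\{m,\dots,n\}$. *)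

theory Defs
  imports Complex_Main
begin

text \<open>
  Undirected simple graphs are pairs of a vertex set and a set of two-element edges.
  The trees of the AFP entry Graph_Theory are not usable here: forests there exclude only
  directed cycles, so a symmetric digraph with an edge is never a forest.
\<close>

type_synonym 'a ugraph = "'a set \<times> 'a set set"

abbreviation uverts :: "'a ugraph \<Rightarrow> 'a set" where "uverts \<equiv> fst"
abbreviation uedges :: "'a ugraph \<Rightarrow> 'a set set" where "uedges \<equiv> snd"

definition uinduced :: "'a ugraph \<Rightarrow> 'a set \<Rightarrow> 'a ugraph" where
  "uinduced G W = (uverts G \<inter> W, {e \<in> uedges G. e \<subseteq> W})"

definition uconnected :: "'a ugraph \<Rightarrow> bool" where
  "uconnected G \<longleftrightarrow> uverts G \<noteq> {} \<and>
     (\<forall>u\<in>uverts G. \<forall>v\<in>uverts G. (u, v) \<in> {(x, y). {x, y} \<in> uedges G}\<^sup>*)"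

text \<open>A cycle is given by the list of its distinct vertices; the closing edge joins the last
  vertex to the first one.\<close>

definition ucycle :: "'a ugraph \<Rightarrow> 'a list \<Rightarrow> bool" where
  "ucycle G p \<longleftrightarrow> 3 \<le> length p \<and> distinct p \<and>
     (\<forall>i<length p. {p ! i, p ! (Suc i mod length p)} \<in> uedges G)"

definition utree :: "'a ugraph \<Rightarrow> bool" where
  "utree G \<longleftrightarrow> uconnected G \<and> (\<nexists>p. ucycle G p)"

text \<open>A spanning tree is identified with its edge set, the vertex set being that of the graph.\<close>

definition spanning_trees :: "'a ugraph \<Rightarrow> 'a set set set" where
  "spanning_trees G = {t. t \<subseteq> uedges G \<and> utree (uverts G, t)}"

definition z_edge :: "int \<Rightarrow> int set" where "z_edge m = {m - 1, m}"
definition h_edge :: "int \<Rightarrow> int set" where "h_edge m = {m - 2, m}"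

definition zigzag_ladder :: "int ugraph" where
  "zigzag_ladder = (UNIV, range z_edge \<union> range h_edge)"

definition zigzag_ladder_between :: "int \<Rightarrow> int \<Rightarrow> int ugraph" where
  "zigzag_ladder_between m n = uinduced zigzag_ladder {m..n}"

definition zigzag_weight :: "real \<Rightarrow> int set \<Rightarrow> real" where
  "zigzag_weight c e = (if e \<in> range z_edge then c else 1)"

lemma zigzag_weight_z_edge: "zigzag_weight c (z_edge m) = c"
  by (simp add: zigzag_weight_def)

lemma zigzag_weight_h_edge: "zigzag_weight c (h_edge m) = 1"
  by (auto simp: zigzag_weight_def z_edge_def h_edge_def doubleton_eq_iff)

end

theory Submission
  imports Defs
begin

text \<open>
  The ladder on \<open>{0..N}\<close> grows by one triangle at a time: the new vertex \<open>v = N + 1\<close> is joined to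
  the two ends \<open>a = N - 1\<close> and \<open>b = N\<close> of an edge that is already there. A spanning tree of the
  larger graph contains at least one of the new edges \<open>av\<close> and \<open>bv\<close>. If it contains exactly
  one, then \<open>v\<close> is a leaf, and deleting it leaves a spanning tree of the smaller graph. If it contains
  both, then replacing the path \<open>a, v, b\<close> by the edge \<open>ab\<close> gives a spanning tree of the
  smaller graph that contains \<open>ab\<close>. All of this is reversible
  (\<open>spanning_trees_attach_triangle\<close>).

  Let \<open>T N\<close> be the weighted number of spanning trees, and let \<open>F N\<close> be the same sum over the trees
  through the last edge \<open>{N - 1, N}\<close> with the weight of that edge left out (equivalently, the weighted
  number of spanning trees after contraction of that edge). The bijection
  gives \<open>T (N + 1) = (1 + c) T N + c F N\<close> and \<open>F (N + 1) = T N + F N\<close>, so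
  \<open>T (N + 2) = (2 + c) T (N + 1) - T N\<close>. The characteristic roots of this recurrence are
  \<open>\<alpha>\<close> and \<open>1 / \<alpha>\<close>, whose sum is \<open>2 + c\<close>, and the initial values
  \<open>T 1 = c\<close> and \<open>T 2 = c (2 + c)\<close> fix the coefficients. At \<open>c = 1\<close> every weight is \<open>1\<close> and
  the sum counts the trees.

  The two graph operations, adding a leaf and subdividing an edge, are verified without handling paths
  or cycles: a tree is a minimally connected graph (\<open>utree_iff_minimally_connected\<close>), and a
  graph is connected iff each 2-colouring that is constant along edges is constant. A
  colouring extends to a new leaf or a new subdividing vertex in exactly one way, so connectedness before
  and after the operation is easy to compare.
\<close>

section \<open>Trees as minimally connected graphs\<close>

text \<open>
  Connectedness of \<open>V\<close> through \<open>E\<close> in terms of cuts: \<open>P\<close> is the indicator of a union of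
  components. In this form a graph operation is followed by transporting colourings instead of paths.
\<close>

definition connects :: "'a set set \<Rightarrow> 'a set \<Rightarrow> bool" where
  "connects E V \<longleftrightarrow> (\<forall>P :: 'a \<Rightarrow> bool. (\<forall>x y. {x, y} \<in> E \<longrightarrow> P x = P y) \<longrightarrow>
     (\<forall>x\<in>V. \<forall>y\<in>V. P x = P y))"

definition edges_on :: "'a set \<Rightarrow> 'a set set \<Rightarrow> bool" where
  "edges_on V E \<longleftrightarrow> (\<forall>e\<in>E. e \<subseteq> V \<and> card e = 2)"

lemma edges_on_mono: "edges_on V E \<Longrightarrow> F \<subseteq> E \<Longrightarrow> edges_on V F"
  unfolding edges_on_def by blast

lemma edges_on_vertices: "edges_on V E \<Longrightarrow> {x, y} \<in> E \<Longrightarrow> x \<in> V \<and> y \<in> V"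
  unfolding edges_on_def by (drule (1) bspec) simp

lemma connectsD:
  fixes P :: "'a \<Rightarrow> bool"
  assumes "connects E V" "\<And>x y. {x, y} \<in> E \<Longrightarrow> P x = P y" "x \<in> V" "y \<in> V"
  shows "P x = P y"
  using assms(1)[unfolded connects_def, rule_format, of P x y] assms(2-4) by simp

lemma connectsI:
  fixes V :: "'a set"
  assumes "\<And>(P :: 'a \<Rightarrow> bool) x y. (\<And>x y. {x, y} \<in> E \<Longrightarrow> P x = P y) \<Longrightarrow> x \<in> V \<Longrightarrow> y \<in> V \<Longrightarrow> P x = P y"
  shows "connects E V"
  unfolding connects_def
proof (intro allI impI ballI)
  fix P :: "'a \<Rightarrow> bool" and x y
  assume "\<forall>x y. {x, y} \<in> E \<longrightarrow> P x = P y" "x \<in> V" "y \<in> V"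
  then show "P x = P y" using assms[of P x y] by blast
qed

lemma eq_ends_cong:
  assumes "{x, y} = {a, b}" "f a = f b"
  shows "f x = f y"
  using assms by (auto simp: doubleton_eq_iff)

lemma rtrancl_edges_if_connects:
  assumes "connects E V" "x \<in> V" "y \<in> V"
  shows "(x, y) \<in> {(x, y). {x, y} \<in> E}\<^sup>*"
proof -
  let ?R = "{(x, y). {x, y} \<in> E}"
  have "((x, x) \<in> ?R\<^sup>*) = ((x, y) \<in> ?R\<^sup>*)"
  proof (rule connectsD[where P = "\<lambda>z. (x, z) \<in> ?R\<^sup>*", OF assms(1)])
    fix u v assume uv: "{u, v} \<in> E"
    then have "(u, v) \<in> ?R" "(v, u) \<in> ?R" by (auto simp: insert_commute)
    then show "((x, u) \<in> ?R\<^sup>*) = ((x, v) \<in> ?R\<^sup>*)"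
      by (meson rtrancl.rtrancl_into_rtrancl)
  qed (use assms in auto)
  then show ?thesis by simp
qed

lemma uconnected_iff_connects:
  "uconnected (V, E) \<longleftrightarrow> V \<noteq> {} \<and> connects E V"
proof -
  define R where "R = {(x, y). {x, y} \<in> E}"
  have connects: "connects E V" if conn: "\<forall>x\<in>V. \<forall>y\<in>V. (x, y) \<in> R\<^sup>*"
  proof (rule connectsI)
    fix P :: "'a \<Rightarrow> bool" and x y
    assume P: "\<And>x y. {x, y} \<in> E \<Longrightarrow> P x = P y" and xy: "x \<in> V" "y \<in> V"
    have "(x, y) \<in> R\<^sup>*" using conn xy by simp
    then show "P x = P y"
    proof (induction rule: rtrancl_induct)
      case (step y z)
      then show ?case using P[of y z] by (simp add: R_def)
    qed simp
  qed
  have reach: "(x, y) \<in> R\<^sup>*" if "connects E V" "x \<in> V" "y \<in> V" for x y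
    using rtrancl_edges_if_connects[OF that] by (simp add: R_def)
  have "(\<forall>x\<in>V. \<forall>y\<in>V. (x, y) \<in> R\<^sup>*) \<longleftrightarrow> connects E V"
  proof
    show "\<forall>x\<in>V. \<forall>y\<in>V. (x, y) \<in> R\<^sup>*" if "connects E V"
      using reach[OF that] by simp
  qed (rule connects)
  then show ?thesis unfolding uconnected_def fst_conv snd_conv R_def by (rule conj_cong[OF refl])
qed

text \<open>
  When a path is extended by a vertex that it already visits, it is cut back to the earlier visit.
\<close>

lemma simple_path_if_rtrancl:
  assumes "(u, v) \<in> R\<^sup>*"
  shows "\<exists>p. p \<noteq> [] \<and> hd p = u \<and> last p = v \<and> distinct p \<and>
    (\<forall>i. Suc i < length p \<longrightarrow> (p ! i, p ! Suc i) \<in> R)"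
  using assms
proof (induction rule: rtrancl_induct)
  case base
  show ?case by (rule exI[of _ "[u]"]) simp
next
  case (step y z)
  then obtain p where p: "p \<noteq> []" "hd p = u" "last p = y" "distinct p"
    "\<And>i. Suc i < length p \<Longrightarrow> (p ! i, p ! Suc i) \<in> R" by blast
  show ?case
  proof (cases "z \<in> set p")
    case True
    then obtain j where j: "j < length p" "p ! j = z" by (metis in_set_conv_nth)
    let ?q = "take (Suc j) p"
    have "last ?q = z" using j by (simp add: take_Suc_conv_app_nth)
    moreover have "hd ?q = u" using p(1,2) by (cases p) auto
    moreover have "(?q ! i, ?q ! Suc i) \<in> R" if "Suc i < length ?q" for i
      using p(5)[of i] that by simp
    ultimately show ?thesis using p(1,4) by (intro exI[of _ ?q]) simp
  next
    case False
    let ?q = "p @ [z]"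
    have "(?q ! i, ?q ! Suc i) \<in> R" if "Suc i < length ?q" for i
    proof (cases "Suc i < length p")
      case True
      then show ?thesis using p(5) by (simp add: nth_append)
    next
      case False
      then have "i = length p - 1" "Suc i = length p" using that by auto
      moreover have "p ! (length p - 1) = y" using p(1,3) by (simp add: last_conv_nth)
      ultimately show ?thesis using step(2) p(1) by (simp add: nth_append)
    qed
    then show ?thesis using p(1,2,4) False by (intro exI[of _ ?q]) simp
  qed
qed

text \<open>
  The closing edge of a cycle is redundant: the rest of the cycle still forces its two ends
  to have the same colour.
\<close>

lemma ucycle_imp_redundant_edge:
  assumes "ucycle (V, E) p"
  shows "\<exists>e\<in>E. \<forall>W. connects E W \<longrightarrow> connects (E - {e}) W"
proof -
  define m where "m = length p - 1"
  have len: "length p = Suc m" and m2: "2 \<le> m" and dist: "distinct p"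
    and edge: "\<And>i. i \<le> m \<Longrightarrow> {p ! i, p ! (Suc i mod Suc m)} \<in> E"
  proof -
    show "length p = Suc m" "2 \<le> m" "distinct p" using assms by (auto simp: ucycle_def m_def)
    then show "{p ! i, p ! (Suc i mod Suc m)} \<in> E" if "i \<le> m" for i
      using assms that by (simp add: ucycle_def)
  qed
  let ?e = "{p ! m, p ! 0}"
  have step: "{p ! i, p ! Suc i} \<in> E - {?e}" if "i < m" for i
  proof -
    have "{p ! i, p ! Suc i} \<noteq> ?e"
      \<comment> \<open>This is where a cycle has to have length at least 3: on two vertices the step
        from the first to the second would be the closing edge.\<close>
      using that m2 dist len by (auto simp: doubleton_eq_iff nth_eq_iff_index_eq)
    then show ?thesis using edge[of i] that by simp
  qed
  have "connects (E - {?e}) W" if W: "connects E W" for W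
  proof (rule connectsI)
    fix P :: "'a \<Rightarrow> bool" and x y
    assume P: "\<And>x y. {x, y} \<in> E - {?e} \<Longrightarrow> P x = P y" and xy: "x \<in> W" "y \<in> W"
    have chain: "P (p ! i) = P (p ! 0)" if "i \<le> m" for i
      using that
    proof (induction i)
      case (Suc i)
      then show ?case using P[OF step[of i]] by simp
    qed simp
    have "P x = P y" if "{x, y} \<in> E" for x y
    proof (cases "{x, y} = ?e")
      case True
      then show ?thesis using chain[OF order_refl] by (rule eq_ends_cong)
    next
      case False
      then show ?thesis using P that by simp
    qed
    then show "P x = P y" by (rule connectsD[OF W _ xy])
  qed
  moreover have "?e \<in> E" using edge[of m] by simp
  ultimately show ?thesis by blast
qed

text \<open>
  A redundant edge closes a simple path that joins its ends and avoids it. The path has at least three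
  vertices, since a path on two would be that edge.
\<close>

lemma redundant_edge_imp_ucycle:
  assumes "{u, v} \<in> E" "u \<noteq> v" "u \<in> V" "v \<in> V" "connects (E - {{u, v}}) V"
  shows "\<exists>p. ucycle (V, E) p"
proof -
  obtain p where p: "p \<noteq> []" "hd p = u" "last p = v" "distinct p"
    "\<And>i. Suc i < length p \<Longrightarrow> {p ! i, p ! Suc i} \<in> E - {{u, v}}"
    using simple_path_if_rtrancl[OF rtrancl_edges_if_connects[OF assms(5,3,4)]] by auto
  define m where "m = length p - 1"
  have len: "length p = Suc m" using p(1) by (simp add: m_def)
  have ends: "p ! 0 = u" "p ! m = v" using p(1-3) by (simp_all add: hd_conv_nth last_conv_nth m_def)
  have "m \<noteq> 0" using ends assms(2) by (metis (no_types))
  moreover have "m \<noteq> 1" using ends p(5)[of 0] len by auto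
  ultimately have "3 \<le> length p" using len by simp
  moreover have "{p ! i, p ! (Suc i mod length p)} \<in> E" if "i < length p" for i
  proof (cases "i = m")
    case True
    then show ?thesis using ends assms(1) len by (simp add: insert_commute)
  next
    case False
    then show ?thesis using p(5)[of i] that len by simp
  qed
  ultimately show ?thesis using p(4) by (auto simp: ucycle_def)
qed

text \<open>
  In a connected graph the edges on cycles are exactly those that can be removed without
  disconnecting it, so acyclicity becomes a statement about connectedness alone.
\<close>

lemma utree_iff_minimally_connected:
  assumes "edges_on V E"
  shows "utree (V, E) \<longleftrightarrow> V \<noteq> {} \<and> connects E V \<and> (\<forall>e\<in>E. \<not> connects (E - {e}) V)"
proof -
  have cycle_iff: "(\<exists>p. ucycle (V, E) p) \<longleftrightarrow> (\<exists>e\<in>E. connects (E - {e}) V)" if "connects E V"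
  proof
    show "\<exists>p. ucycle (V, E) p \<Longrightarrow> \<exists>e\<in>E. connects (E - {e}) V"
      using ucycle_imp_redundant_edge that by blast
    assume "\<exists>e\<in>E. connects (E - {e}) V"
    then obtain e where e: "e \<in> E" "connects (E - {e}) V" by blast
    then have "e \<subseteq> V" "card e = 2" using assms unfolding edges_on_def by auto
    then obtain u v where "e = {u, v}" "u \<noteq> v" "u \<in> V" "v \<in> V"
      unfolding card_2_iff by auto
    then show "\<exists>p. ucycle (V, E) p" using e redundant_edge_imp_ucycle[of u v E V] by blast
  qed
  show ?thesis
  proof (cases "connects E V")
    case True
    then show ?thesis using cycle_iff[OF True] by (simp add: utree_def uconnected_iff_connects)
  qed (simp add: utree_def uconnected_iff_connects)
qed

section \<open>Leaves and subdivided edges\<close>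

text \<open>A colouring of \<open>V\<close> extends to the leaf \<open>v\<close> by the colour of its neighbour.\<close>

lemma connects_leaf:
  fixes V :: "'a set"
  assumes E: "edges_on V E" and u: "u \<in> V" and v: "v \<notin> V"
  shows "connects (insert {u, v} E) (insert v V) \<longleftrightarrow> connects E V"
proof
  assume L: "connects (insert {u, v} E) (insert v V)"
  show "connects E V"
  proof (rule connectsI)
    fix P :: "'a \<Rightarrow> bool" and x y
    assume P: "\<And>x y. {x, y} \<in> E \<Longrightarrow> P x = P y" and xy: "x \<in> V" "y \<in> V"
    let ?Q = "P(v := P u)"
    have Q: "?Q x = P x" if "x \<in> V" for x using that v by auto
    have "?Q x = ?Q y"
    proof (rule connectsD[where P = ?Q, OF L])
      fix x y assume "{x, y} \<in> insert {u, v} E"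
      then consider "{x, y} = {u, v}" | "{x, y} \<in> E" by blast
      then show "?Q x = ?Q y"
      proof cases
        case 1
        then show ?thesis by (rule eq_ends_cong) simp
      next
        case 2
        then show ?thesis using P[OF 2] Q edges_on_vertices[OF E 2] by simp
      qed
    qed (use xy in auto)
    then show "P x = P y" using Q xy by simp
  qed
next
  assume R: "connects E V"
  show "connects (insert {u, v} E) (insert v V)"
  proof (rule connectsI)
    fix P :: "'a \<Rightarrow> bool" and x y
    assume P: "\<And>x y. {x, y} \<in> insert {u, v} E \<Longrightarrow> P x = P y"
      and xy: "x \<in> insert v V" "y \<in> insert v V"
    have "P x = P u" if "x \<in> V" for x
      by (rule connectsD[OF R _ that u]) (simp add: P)
    moreover have "P u = P v" by (rule P) simp
    ultimately show "P x = P y" using xy by auto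
  qed
qed

text \<open>
  The path \<open>a, v, b\<close> and the edge \<open>ab\<close> impose the same condition, equality of the colours
  of \<open>a\<close> and \<open>b\<close>.
\<close>

lemma connects_subdivide:
  fixes V :: "'a set"
  assumes E: "edges_on V E" and a: "a \<in> V" and b: "b \<in> V" and v: "v \<notin> V"
  shows "connects (insert {a, v} (insert {b, v} E)) (insert v V) \<longleftrightarrow> connects (insert {a, b} E) V"
proof
  assume L: "connects (insert {a, v} (insert {b, v} E)) (insert v V)"
  show "connects (insert {a, b} E) V"
  proof (rule connectsI)
    fix P :: "'a \<Rightarrow> bool" and x y
    assume P: "\<And>x y. {x, y} \<in> insert {a, b} E \<Longrightarrow> P x = P y" and xy: "x \<in> V" "y \<in> V"
    let ?Q = "P(v := P a)"
    have Q: "?Q x = P x" if "x \<in> V" for x using that v by auto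
    have ab: "P a = P b" by (rule P) simp
    have "?Q x = ?Q y"
    proof (rule connectsD[where P = ?Q, OF L])
      fix x y assume "{x, y} \<in> insert {a, v} (insert {b, v} E)"
      then consider "{x, y} = {a, v}" | "{x, y} = {b, v}" | "{x, y} \<in> E" by blast
      then show "?Q x = ?Q y"
      proof cases
        case 1
        then show ?thesis by (rule eq_ends_cong) simp
      next
        case 2
        then show ?thesis by (rule eq_ends_cong) (simp add: ab)
      next
        case 3
        then show ?thesis using P[of x y] Q edges_on_vertices[OF E 3] by simp
      qed
    qed (use xy in auto)
    then show "P x = P y" using Q xy by simp
  qed
next
  assume R: "connects (insert {a, b} E) V"
  show "connects (insert {a, v} (insert {b, v} E)) (insert v V)"
  proof (rule connectsI)
    fix P :: "'a \<Rightarrow> bool" and x y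
    assume P: "\<And>x y. {x, y} \<in> insert {a, v} (insert {b, v} E) \<Longrightarrow> P x = P y"
      and xy: "x \<in> insert v V" "y \<in> insert v V"
    have av: "P a = P v" by (rule P) simp
    have bv: "P b = P v" by (rule P) simp
    have "P x = P a" if "x \<in> V" for x
    proof (rule connectsD[OF R _ that a])
      fix x y assume "{x, y} \<in> insert {a, b} E"
      then consider "{x, y} = {a, b}" | "{x, y} \<in> E" by blast
      then show "P x = P y"
      proof cases
        case 1
        then show ?thesis by (rule eq_ends_cong) (simp add: av bv)
      qed (simp add: P)
    qed
    then show "P x = P y" using xy av by auto
  qed
qed

lemma not_connects_isolated:
  assumes "edges_on V E" "u \<in> V" "v \<notin> V"
  shows "\<not> connects E (insert v V)"
proof
  assume "connects E (insert v V)"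
  from connectsD[OF this, of "\<lambda>x. x = v" u v] show False
    using edges_on_vertices[OF assms(1)] assms(2,3) by auto
qed

lemma edges_on_insert:
  assumes "edges_on V E" "a \<in> V" "v \<notin> V"
  shows "edges_on (insert v V) (insert {a, v} E)"
proof -
  have "a \<noteq> v" using assms by blast
  then show ?thesis using assms unfolding edges_on_def by auto
qed

lemma notin_edges: "edges_on V E \<Longrightarrow> v \<notin> V \<Longrightarrow> {a, v} \<notin> E"
  by (auto dest: edges_on_vertices)

lemma utree_leaf:
  assumes E: "edges_on V E" and u: "u \<in> V" and v: "v \<notin> V"
  shows "utree (insert v V, insert {u, v} E) \<longleftrightarrow> utree (V, E)"
proof -
  have new: "{u, v} \<notin> E" using notin_edges[OF E v] .
  have "insert {u, v} E - {{u, v}} = E" using new by blast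
  moreover have "insert {u, v} E - {e} = insert {u, v} (E - {e})" if "e \<in> E" for e
    using that new by blast
  moreover have "connects (insert {u, v} (E - {e})) (insert v V) \<longleftrightarrow> connects (E - {e}) V" for e
    by (rule connects_leaf[OF edges_on_mono[OF E] u v]) blast
  ultimately show ?thesis
    unfolding utree_iff_minimally_connected[OF edges_on_insert[OF E u v]]
      utree_iff_minimally_connected[OF E]
    using connects_leaf[OF E u v] not_connects_isolated[OF E u v] u by auto
qed

text \<open>
  Removing \<open>av\<close> or \<open>bv\<close> turns \<open>v\<close> into a leaf, which for connectedness amounts to
  removing \<open>ab\<close>; removing any other edge commutes with the subdivision. If \<open>ab\<close> itself is in \<open>E\<close>,
  then \<open>a, v, b\<close> is a triangle and the left-hand side fails.
\<close>

lemma utree_subdivide: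
  assumes E: "edges_on V E" and a: "a \<in> V" and b: "b \<in> V" and v: "v \<notin> V" and ab: "a \<noteq> b"
  shows "utree (insert v V, insert {a, v} (insert {b, v} E)) \<longleftrightarrow>
    {a, b} \<notin> E \<and> utree (V, insert {a, b} E)"
proof -
  let ?F = "insert {a, v} (insert {b, v} E)"
  have new: "{a, v} \<notin> E" "{b, v} \<notin> E" using notin_edges[OF E v] by auto
  have ne: "{a, v} \<noteq> {b, v}" using ab by (auto simp: doubleton_eq_iff)
  have F: "edges_on (insert v V) ?F" 
  proof -
    have "a \<noteq> v" "b \<noteq> v" using a b v by auto
    then show ?thesis using E a b unfolding edges_on_def by auto
  qed
  have E': "edges_on V (insert {a, b} E)" using E a b ab unfolding edges_on_def by auto
  have "?F - {{a, v}} = insert {b, v} E" "?F - {{b, v}} = insert {a, v} E" using new ne by blast+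
  then have rem: "connects (?F - {{a, v}}) (insert v V) \<longleftrightarrow> connects E V"
    "connects (?F - {{b, v}}) (insert v V) \<longleftrightarrow> connects E V"
    using connects_leaf[OF E _ v] a b by simp_all
  have "connects (insert {a, v} (insert {b, v} (E - {e}))) (insert v V) \<longleftrightarrow>
      connects (insert {a, b} (E - {e})) V" for e
    by (rule connects_subdivide[OF edges_on_mono[OF E] a b v]) blast
  moreover have "?F - {e} = insert {a, v} (insert {b, v} (E - {e}))" if "e \<in> E" for e
    using that new by blast
  ultimately have old: "connects (?F - {e}) (insert v V) \<longleftrightarrow> connects (insert {a, b} (E - {e})) V"
    if "e \<in> E" for e using that by simp
  have all: "connects ?F (insert v V) \<longleftrightarrow> connects (insert {a, b} E) V"
    by (rule connects_subdivide[OF E a b v])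
  show ?thesis
  proof (cases "{a, b} \<in> E")
    case True
    \<comment> \<open>The detour through \<open>v\<close> makes \<open>ab\<close> redundant.\<close>
    then have "insert {a, b} (E - {{a, b}}) = insert {a, b} E" by blast
    then have "connects (?F - {{a, b}}) (insert v V) \<longleftrightarrow> connects ?F (insert v V)"
      using old[OF True] all by simp
    then show ?thesis using True utree_iff_minimally_connected[OF F] by blast
  next
    case False
    have "insert {a, b} E - {{a, b}} = E" using False by blast
    moreover have "insert {a, b} E - {e} = insert {a, b} (E - {e})" if "e \<in> E" for e
      using that False by blast
    ultimately show ?thesis
      unfolding utree_iff_minimally_connected[OF F] utree_iff_minimally_connected[OF E']
      using rem old all a False by auto
  qed
qed

lemma not_utree_isolated:
  assumes "edges_on V E" "u \<in> V" "v \<notin> V"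
  shows "\<not> utree (insert v V, E)"
  using not_connects_isolated[OF assms] uconnected_iff_connects[of "insert v V" E]
  by (auto simp: utree_def)

section \<open>Attaching a triangle to an edge\<close>

text \<open>
  The three parts are the trees that meet the new vertex in \<open>av\<close> only, in \<open>bv\<close> only, and in
  both. A tree of the third kind cannot contain \<open>ab\<close>, as this would close a triangle, so it comes
  from subdividing \<open>ab\<close> in exactly one tree of the old graph.
\<close>

lemma spanning_trees_attach_triangle:
  fixes V :: "'a set"
  assumes E: "edges_on V E" and ab: "{a, b} \<in> E" "a \<noteq> b" and v: "v \<notin> V"
  shows "spanning_trees (insert v V, insert {a, v} (insert {b, v} E)) =
    insert {a, v} ` spanning_trees (V, E) \<union> insert {b, v} ` spanning_trees (V, E) \<union>
    (\<lambda>t. insert {a, v} (insert {b, v} (t - {{a, b}}))) ` {t \<in> spanning_trees (V, E). {a, b} \<in> t}"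
    (is "?L = ?A \<union> ?B \<union> ?C")
proof -
  have a: "a \<in> V" and b: "b \<in> V" using edges_on_vertices[OF E ab(1)] by auto
  have on: "edges_on V t" if "t \<subseteq> E" for t by (rule edges_on_mono[OF E that])
  show ?thesis
  proof (intro equalityI subsetI)
    fix t assume "t \<in> ?L"
    then have sub: "t \<subseteq> insert {a, v} (insert {b, v} E)" and t: "utree (insert v V, t)"
      by (auto simp: spanning_trees_def)
    define s where "s = t - {{a, v}, {b, v}}"
    have s: "s \<subseteq> E" using sub s_def by blast
    consider "t = s" | "t = insert {a, v} s" | "t = insert {b, v} s"
      | "t = insert {a, v} (insert {b, v} s)" using s_def by blast
    then show "t \<in> ?A \<union> ?B \<union> ?C"
    proof cases
      case 1
      then show ?thesis using not_utree_isolated[OF on[OF s] a v] t by simp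
    next
      case 2
      then show ?thesis using utree_leaf[OF on[OF s] a v] t s by (auto simp: spanning_trees_def)
    next
      case 3
      then show ?thesis using utree_leaf[OF on[OF s] b v] t s by (auto simp: spanning_trees_def)
    next
      case 4
      then have r: "{a, b} \<notin> s" "utree (V, insert {a, b} s)"
        using utree_subdivide[OF on[OF s] a b v ab(2)] t by auto
      then have "insert {a, b} s \<in> {t \<in> spanning_trees (V, E). {a, b} \<in> t}"
        using s ab(1) by (auto simp: spanning_trees_def)
      moreover have "s = insert {a, b} s - {{a, b}}" using r(1) by blast
      ultimately have "t \<in> ?C" using 4 by (metis (no_types, lifting) imageI)
      then show ?thesis by blast
    qed
  next
    fix t assume "t \<in> ?A \<union> ?B \<union> ?C"
    then consider s where "t = insert {a, v} s" "s \<in> spanning_trees (V, E)"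
      | s where "t = insert {b, v} s" "s \<in> spanning_trees (V, E)"
      | s where "t = insert {a, v} (insert {b, v} (s - {{a, b}}))" "s \<in> spanning_trees (V, E)"
          "{a, b} \<in> s" by blast
    then show "t \<in> ?L"
    proof cases
      case (1 s)
      then show ?thesis using utree_leaf[OF on a v, of s] by (auto simp: spanning_trees_def)
    next
      case (2 s)
      then show ?thesis using utree_leaf[OF on b v, of s] by (auto simp: spanning_trees_def)
    next
      case (3 s)
      then have "s \<subseteq> E" "utree (V, s)" by (auto simp: spanning_trees_def)
      moreover have "insert {a, b} (s - {{a, b}}) = s" using 3(3) by blast
      moreover have "s - {{a, b}} \<subseteq> E" using \<open>s \<subseteq> E\<close> by blast
      ultimately show ?thesis using 3 utree_subdivide[OF on a b v ab(2), of "s - {{a, b}}"]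
        by (auto simp: spanning_trees_def)
    qed
  qed
qed

definition tree_sum :: "('a set \<Rightarrow> real) \<Rightarrow> 'a ugraph \<Rightarrow> real" where
  "tree_sum w G = (\<Sum>t\<in>spanning_trees G. \<Prod>e\<in>t. w e)"

text \<open>
  The weighted number of spanning trees of the graph in which the edge \<open>f\<close> has been contracted. Omitting
  the factor \<open>w f\<close>, rather than dividing by it, allows zero weights.
\<close>

definition contracted_tree_sum :: "('a set \<Rightarrow> real) \<Rightarrow> 'a ugraph \<Rightarrow> 'a set \<Rightarrow> real" where
  "contracted_tree_sum w G f = (\<Sum>t\<in>{t \<in> spanning_trees G. f \<in> t}. \<Prod>e\<in>t - {f}. w e)"

text \<open>
  The two sums have to be followed together: subdividing singles out the trees through \<open>ab\<close>, and in the
  next step \<open>bv\<close> takes the place of \<open>ab\<close>.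
\<close>

lemma tree_sums_attach_triangle:
  fixes w :: "'a set \<Rightarrow> real"
  assumes E: "edges_on V E" and fin: "finite E" and ab: "{a, b} \<in> E" "a \<noteq> b" and v: "v \<notin> V"
  defines "G \<equiv> (V, E)" and "H \<equiv> (insert v V, insert {a, v} (insert {b, v} E))"
  shows "tree_sum w H = (w {a, v} + w {b, v}) * tree_sum w G
      + w {a, v} * w {b, v} * contracted_tree_sum w G {a, b}"
    and "contracted_tree_sum w H {b, v} = tree_sum w G + w {a, v} * contracted_tree_sum w G {a, b}"
proof -
  let ?S = "spanning_trees G"
  let ?Sab = "{t \<in> ?S. {a, b} \<in> t}"
  let ?sub = "\<lambda>t. insert {a, v} (insert {b, v} (t - {{a, b}}))"
  have sub: "t \<subseteq> E" if "t \<in> ?S" for t using that by (simp add: spanning_trees_def G_def)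
  have finS: "finite ?S"
    by (rule finite_subset[of _ "Pow E"]) (use sub fin in auto)
  have fint: "finite t" if "t \<in> ?S" for t using sub[OF that] fin finite_subset by blast
  have new: "{a, v} \<notin> E" "{b, v} \<notin> E" using notin_edges[OF E v] by auto
  then have newt: "{a, v} \<notin> t" "{b, v} \<notin> t" if "t \<in> ?S" for t using sub[OF that] by auto
  have ne: "{a, v} \<noteq> {b, v}" using ab by (auto simp: doubleton_eq_iff)
  have inj: "inj_on (insert {a, v}) ?S" "inj_on (insert {b, v}) ?S"
    by (intro inj_onI; use newt insert_ident in metis)+
  have inj_sub: "inj_on ?sub ?Sab"
    \<comment> \<open>Undoing the subdivision recovers the tree.\<close>
  proof (rule inj_on_inverseI[where g = "\<lambda>t. insert {a, b} (t - {{a, v}, {b, v}})"])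
    fix t assume "t \<in> ?Sab"
    then show "insert {a, b} (?sub t - {{a, v}, {b, v}}) = t" using newt[of t] by blast
  qed
  have H: "spanning_trees H = insert {a, v} ` ?S \<union> insert {b, v} ` ?S \<union> ?sub ` ?Sab"
    unfolding H_def G_def by (rule spanning_trees_attach_triangle[OF E ab v])
  have mem: "{a, v} \<notin> insert {b, v} s" "{b, v} \<notin> insert {a, v} s" if "s \<in> ?S" for s
    using newt[OF that] ne by auto
  have dis: "insert x ` ?S \<inter> Y = {}" if "\<And>s. s \<in> ?S \<Longrightarrow> insert x s \<notin> Y" for x and Y :: "'a set set set"
    using that by blast
  have dis1: "insert {a, v} ` ?S \<inter> insert {b, v} ` ?S = {}"
    by (rule dis) (metis imageE insertI1 mem(2))
  have dis2: "insert {a, v} ` ?S \<inter> ?sub ` ?Sab = {}" "insert {b, v} ` ?S \<inter> ?sub ` ?Sab = {}"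
    by (rule dis; metis (no_types, lifting) imageE insertI1 insertI2 mem)+
  have A: "(\<Sum>t\<in>insert x ` ?S. \<Prod>e\<in>t. w e) = w x * tree_sum w G"
    if "inj_on (insert x) ?S" "x \<notin> E" for x
  proof -
    have "(\<Prod>e\<in>insert x t. w e) = w x * (\<Prod>e\<in>t. w e)" if "t \<in> ?S" for t
      using fint[OF that] sub[OF that] \<open>x \<notin> E\<close> by (subst prod.insert) auto
    then show ?thesis
      by (simp add: sum.reindex[OF that(1)] tree_sum_def sum_distrib_left)
  qed
  have prod_sub: "(\<Prod>e\<in>?sub t. w e) = w {a, v} * (w {b, v} * (\<Prod>e\<in>t - {{a, b}}. w e))"
    "(\<Prod>e\<in>?sub t - {{b, v}}. w e) = w {a, v} * (\<Prod>e\<in>t - {{a, b}}. w e)"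
    if "t \<in> ?Sab" for t
  proof -
    have t: "finite t" "{a, v} \<notin> t" "{b, v} \<notin> t" using that fint newt by auto
    show "(\<Prod>e\<in>?sub t. w e) = w {a, v} * (w {b, v} * (\<Prod>e\<in>t - {{a, b}}. w e))"
      using t ne by simp
    have "?sub t - {{b, v}} = insert {a, v} (t - {{a, b}})" using t ne by blast
    then show "(\<Prod>e\<in>?sub t - {{b, v}}. w e) = w {a, v} * (\<Prod>e\<in>t - {{a, b}}. w e)"
      using t by simp
  qed
  have C: "(\<Sum>t\<in>?sub ` ?Sab. \<Prod>e\<in>t. w e)
      = w {a, v} * w {b, v} * contracted_tree_sum w G {a, b}"
    unfolding sum.reindex[OF inj_sub] comp_def contracted_tree_sum_def sum_distrib_left
    by (intro sum.cong refl) (simp only: prod_sub(1) mult.assoc)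
  have finI: "finite (insert x ` ?S)" "finite (?sub ` ?Sab)" for x using finS by auto
  have dis12: "(insert {a, v} ` ?S \<union> insert {b, v} ` ?S) \<inter> ?sub ` ?Sab = {}"
    unfolding Int_Un_distrib2 dis2 by (rule Un_empty_left)
  have "tree_sum w H = (\<Sum>t\<in>insert {a, v} ` ?S. \<Prod>e\<in>t. w e)
      + (\<Sum>t\<in>insert {b, v} ` ?S. \<Prod>e\<in>t. w e) + (\<Sum>t\<in>?sub ` ?Sab. \<Prod>e\<in>t. w e)"
    unfolding tree_sum_def[of w H] H
    unfolding sum.union_disjoint[OF finite_UnI[OF finI(1) finI(1)] finI(2) dis12]
      sum.union_disjoint[OF finI(1) finI(1) dis1] by (rule refl)
  then show "tree_sum w H = (w {a, v} + w {b, v}) * tree_sum w G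
      + w {a, v} * w {b, v} * contracted_tree_sum w G {a, b}"
    using A[OF inj(1) new(1)] A[OF inj(2) new(2)] C by (simp add: algebra_simps)
  have "{t \<in> spanning_trees H. {b, v} \<in> t} = insert {b, v} ` ?S \<union> ?sub ` ?Sab"
  proof -
    have filter: "{t \<in> X \<union> Y \<union> Z. {b, v} \<in> t} = Y \<union> Z"
      if "\<forall>t\<in>X. {b, v} \<notin> t" "\<forall>t\<in>Y. {b, v} \<in> t" "\<forall>t\<in>Z. {b, v} \<in> t"
      for X Y Z :: "'a set set set" using that by auto
    show ?thesis unfolding H by (rule filter) (simp_all add: newt ne[symmetric])
  qed
  then have "contracted_tree_sum w H {b, v} = (\<Sum>t\<in>insert {b, v} ` ?S. \<Prod>e\<in>t - {{b, v}}. w e)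
      + (\<Sum>t\<in>?sub ` ?Sab. \<Prod>e\<in>t - {{b, v}}. w e)"
    unfolding contracted_tree_sum_def[of w H]
    by (simp only: sum.union_disjoint[OF finI(1) finI(2) dis2(2)])
  moreover have "(\<Sum>t\<in>insert {b, v} ` ?S. \<Prod>e\<in>t - {{b, v}}. w e) = tree_sum w G"
    unfolding sum.reindex[OF inj(2)] comp_def tree_sum_def
    by (intro sum.cong refl) (simp add: newt)
  moreover have "(\<Sum>t\<in>?sub ` ?Sab. \<Prod>e\<in>t - {{b, v}}. w e)
      = w {a, v} * contracted_tree_sum w G {a, b}"
    unfolding sum.reindex[OF inj_sub] comp_def contracted_tree_sum_def sum_distrib_left
    by (intro sum.cong refl) (simp only: prod_sub(2))
  ultimately show "contracted_tree_sum w H {b, v}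
      = tree_sum w G + w {a, v} * contracted_tree_sum w G {a, b}" by simp
qed

section \<open>The zigzag ladder\<close>

text \<open>
  The index is the number of the last vertex, so \<open>ladder N\<close> has \<open>N + 1\<close> vertices and the
  exponents of the closed form are \<open>N\<close> and \<open>- N\<close>.
\<close>

definition ladder :: "nat \<Rightarrow> int ugraph" where
  "ladder N = zigzag_ladder_between 0 (int N)"

lemma ladder_conv: "ladder N = ({0..int N}, {e \<in> range z_edge \<union> range h_edge. e \<subseteq> {0..int N}})"
  by (simp add: ladder_def zigzag_ladder_between_def uinduced_def zigzag_ladder_def)

lemma edges_on_ladder: "edges_on {0..int N} (uedges (ladder N))"
  by (auto simp: edges_on_def ladder_conv z_edge_def h_edge_def)

lemma ladder_1: "ladder 1 = (insert 1 {0}, {{0, 1}})"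
proof -
  have "{0..int 1} = insert 1 {0}" by auto
  moreover have "e = {0, 1}" if "e \<in> range z_edge \<union> range h_edge" "e \<subseteq> {0..1::int}" for e
    using that by (auto simp: z_edge_def h_edge_def doubleton_eq_iff)
  moreover have "z_edge 1 = {0, 1}" by (simp add: z_edge_def)
  ultimately show ?thesis unfolding ladder_conv by auto
qed

text \<open>
  For \<open>N = 0\<close> this would fail: the edge \<open>{N - 1, N + 1}\<close> would then leave the vertex set.
\<close>

lemma ladder_Suc:
  assumes "1 \<le> N"
  defines "v \<equiv> int (Suc N)"
  shows "ladder (Suc N) = (insert v {0..int N},
    insert {int N - 1, v} (insert {int N, v} (uedges (ladder N))))"
proof -
  have 1: "{0..int (Suc N)} = insert v {0..int N}" by (auto simp: v_def)
  have z: "z_edge v = {int N, v}" and h: "h_edge v = {int N - 1, v}"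
    by (simp_all add: v_def z_edge_def h_edge_def)
  have ze: "e \<subseteq> {0..int N} \<or> e = z_edge v" if e: "e \<in> range z_edge" "e \<subseteq> insert v {0..int N}" for e
  proof -
    obtain m where m: "e = z_edge m" using e(1) by (rule rangeE)
    then have "1 \<le> m" "m \<le> v" using e(2) unfolding 1[symmetric] by (simp_all add: z_edge_def v_def)
    then have "m = v \<or> e \<subseteq> {0..int N}" by (simp add: m z_edge_def v_def) linarith
    then show ?thesis using m by blast
  qed
  have he: "e \<subseteq> {0..int N} \<or> e = h_edge v" if e: "e \<in> range h_edge" "e \<subseteq> insert v {0..int N}" for e
  proof -
    obtain m where m: "e = h_edge m" using e(1) by (rule rangeE)
    then have "2 \<le> m" "m \<le> v" using e(2) unfolding 1[symmetric] by (simp_all add: h_edge_def v_def)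
    then have "m = v \<or> e \<subseteq> {0..int N}" by (simp add: m h_edge_def v_def) linarith
    then show ?thesis using m by blast
  qed
  have "{e \<in> range z_edge \<union> range h_edge. e \<subseteq> insert v {0..int N}} =
     insert (h_edge v) (insert (z_edge v) {e \<in> range z_edge \<union> range h_edge. e \<subseteq> {0..int N}})"
    (is "?L = ?R")
  proof
    show "?L \<subseteq> ?R" using ze he by blast
    have "z_edge v \<subseteq> insert v {0..int N}" "h_edge v \<subseteq> insert v {0..int N}"
      unfolding z h using assms(1) by auto
    then show "?R \<subseteq> ?L" by blast
  qed
  then show ?thesis unfolding ladder_conv 1 z h by simp
qed

lemma finite_edges_ladder: "finite (uedges (ladder N))"
  by (rule finite_subset[of _ "Pow {0..int N}"]) (auto simp: ladder_conv)

lemma last_rung_in_ladder: "1 \<le> N \<Longrightarrow> {int N - 1, int N} \<in> uedges (ladder N)"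
  by (auto simp: ladder_conv z_edge_def)

lemma spanning_trees_ladder_1: "spanning_trees (ladder 1) = {{{0, 1}}}"
proof -
  have e: "edges_on {0::int} {}" by (simp add: edges_on_def)
  have "utree ({0::int}, {})"
    unfolding utree_iff_minimally_connected[OF e] by (simp add: connects_def)
  then have "utree (insert 1 {0::int}, {{0, 1}})" using utree_leaf[OF e, of 0 1] by simp
  moreover have "\<not> utree (insert 1 {0::int}, {})" using not_utree_isolated[OF e, of 0 1] by simp
  ultimately show ?thesis unfolding ladder_1 spanning_trees_def by (auto simp: subset_singleton_iff)
qed

lemma tree_sums_ladder_1:
  "tree_sum (zigzag_weight c) (ladder 1) = c"
  "contracted_tree_sum (zigzag_weight c) (ladder 1) {0, 1} = 1"
proof -
  have "zigzag_weight c {0, 1} = c" using zigzag_weight_z_edge[of c 1] by (simp add: z_edge_def)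
  then show "tree_sum (zigzag_weight c) (ladder 1) = c"
    unfolding tree_sum_def spanning_trees_ladder_1 by simp
  have "{t \<in> {{{0::int, 1}}}. {0, 1} \<in> t} = {{{0, 1}}}" by auto
  then show "contracted_tree_sum (zigzag_weight c) (ladder 1) {0, 1} = 1"
    unfolding contracted_tree_sum_def spanning_trees_ladder_1 by simp
qed

lemma tree_sums_ladder_Suc:
  fixes c :: real
  assumes "1 \<le> N"
  defines "T \<equiv> \<lambda>N. tree_sum (zigzag_weight c) (ladder N)"
    and "F \<equiv> \<lambda>N. contracted_tree_sum (zigzag_weight c) (ladder N) {int N - 1, int N}"
  shows "T (Suc N) = (1 + c) * T N + c * F N" and "F (Suc N) = T N + F N"
proof -
  let ?v = "int (Suc N)"
  have wz: "zigzag_weight c {int N, ?v} = c"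
    using zigzag_weight_z_edge[of c ?v] by (simp add: z_edge_def)
  have wh: "zigzag_weight c {int N - 1, ?v} = 1"
    using zigzag_weight_h_edge[of c ?v] by (simp add: h_edge_def)
  have pair: "({0..int N}, uedges (ladder N)) = ladder N" by (simp add: ladder_conv)
  note rec = tree_sums_attach_triangle[OF edges_on_ladder finite_edges_ladder
      last_rung_in_ladder[OF assms(1)], where v = ?v and w = "zigzag_weight c",
      folded ladder_Suc[OF assms(1)], unfolded pair wz wh]
  show "T (Suc N) = (1 + c) * T N + c * F N" using rec(1) by (simp add: T_def F_def)
  show "F (Suc N) = T N + F N" using rec(2) by (simp add: T_def F_def)
qed

section \<open>Solving the recurrence\<close>

text \<open>
  Eliminating the contracted sum leaves a second-order recurrence, which the right-hand side satisfies
  because \<open>\<alpha>\<close> and \<open>1 / \<alpha>\<close> have sum \<open>2 + c\<close> and product \<open>1\<close>.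
\<close>

lemma tree_sum_ladder_closed_form:
  fixes c \<alpha> :: real
  assumes \<alpha>: "0 < \<alpha>" "\<alpha> + 1 / \<alpha> = 2 + c" and N: "1 \<le> N"
  shows "tree_sum (zigzag_weight c) (ladder N) = (1 - \<alpha>) / (1 + \<alpha>) * ((1 / \<alpha>) ^ N - \<alpha> ^ N)"
proof -
  define T where "T = (\<lambda>N. tree_sum (zigzag_weight c) (ladder N))"
  define F where "F = (\<lambda>N. contracted_tree_sum (zigzag_weight c) (ladder N) {int N - 1, int N})"
  define \<beta> where "\<beta> = 1 / \<alpha>"
  define X where "X = (\<lambda>N. (1 - \<alpha>) / (1 + \<alpha>) * (\<beta> ^ N - \<alpha> ^ N))"
  have ab: "\<alpha> * \<beta> = 1" using \<alpha>(1) by (simp add: \<beta>_def)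
  have c: "c = \<alpha> + \<beta> - 2" using \<alpha>(2) by (simp add: \<beta>_def)
  have recT: "T (Suc k) = (1 + c) * T k + c * F k" "F (Suc k) = T k + F k" if "1 \<le> k" for k
    using tree_sums_ladder_Suc[OF that, of c] by (simp_all add: T_def F_def)
  have start: "T 1 = c" "F 1 = 1" using tree_sums_ladder_1[of c] by (simp_all add: T_def F_def)
  have "(1 - \<alpha>) * (\<beta> - \<alpha>) = (1 + \<alpha>) * c" using ab unfolding c by algebra
  then have X1: "X 1 = c" using \<alpha>(1) by (simp add: X_def)
  have X2: "X 2 = c * (2 + c)"
  proof -
    have "X 2 = X 1 * (\<beta> + \<alpha>)" unfolding X_def by (simp add: power2_eq_square algebra_simps)
    then show ?thesis using X1 c by simp
  qed
  have recX: "X (Suc (Suc k)) = (2 + c) * X (Suc k) - X k" for k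
  proof -
    have "\<beta> ^ Suc (Suc k) - \<alpha> ^ Suc (Suc k)
        = (\<alpha> + \<beta>) * (\<beta> ^ Suc k - \<alpha> ^ Suc k) - \<alpha> * \<beta> * (\<beta> ^ k - \<alpha> ^ k)"
      by (simp add: algebra_simps)
    then have "\<beta> ^ Suc (Suc k) - \<alpha> ^ Suc (Suc k)
        = (2 + c) * (\<beta> ^ Suc k - \<alpha> ^ Suc k) - (\<beta> ^ k - \<alpha> ^ k)"
      using ab c by simp
    then show ?thesis unfolding X_def by (simp add: right_diff_distrib mult.left_commute)
  qed
  have "T k = X k \<and> T (Suc k) = X (Suc k)" if "1 \<le> k" for k
    using that
  proof (induction rule: dec_induct)
    case base
    have "T (Suc 1) = c * (2 + c)" using recT[of 1] start by (simp add: algebra_simps)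
    moreover have "X (Suc 1) = c * (2 + c)" using X2 by (simp add: numeral_2_eq_2)
    ultimately show ?case using start X1 by (simp add: One_nat_def)
  next
    case (step k)
    have "T (Suc (Suc k)) = (2 + c) * T (Suc k) - T k"
      using recT[of k] recT[of "Suc k"] step(1) by (simp add: algebra_simps)
    then show ?case using step recX by simp
  qed
  then show ?thesis using N by (simp add: T_def X_def \<beta>_def)
qed

text \<open>
  The given \<open>\<alpha>\<close> is the smaller root of \<open>x\<^sup>2 - (2 + c) x + 1\<close>. It is positive because
  \<open>4 c + c\<^sup>2 < (2 + c)\<^sup>2\<close>.
\<close>

lemma decay_rate_eq:
  fixes c \<alpha> :: real
  assumes "0 < c" "\<alpha> = 1 + c / 2 - sqrt (4 * c + c\<^sup>2) / 2"
  shows "0 < \<alpha>" "\<alpha> + 1 / \<alpha> = 2 + c"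
proof -
  have "sqrt (4 * c + c\<^sup>2) < sqrt ((2 + c)\<^sup>2)"
    by (rule real_sqrt_less_mono) (simp add: power2_eq_square algebra_simps)
  then show pos: "0 < \<alpha>" using assms by simp
  have "(sqrt (4 * c + c\<^sup>2))\<^sup>2 = 4 * c + c\<^sup>2" using assms(1) by simp
  then have "\<alpha> * \<alpha> + 1 = (2 + c) * \<alpha>"
    unfolding assms(2) by (simp add: power2_eq_square field_simps)
  then show "\<alpha> + 1 / \<alpha> = 2 + c" using pos by (simp add: field_simps)
qed

lemma card_spanning_trees_eq_tree_sum:
  "real (card (spanning_trees G)) = tree_sum (zigzag_weight 1) G"
  by (simp add: tree_sum_def zigzag_weight_def)

theorem proposition1p7:
  fixes c \<alpha> :: real and n :: nat
  assumes "0 < c"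
    and "\<alpha> = 1 + c / 2 - sqrt (4 * c + c\<^sup>2) / 2"
    and "2 \<le> n"
  shows "(\<Sum>t\<in>spanning_trees (zigzag_ladder_between 0 (int n - 1)). \<Prod>e\<in>t. zigzag_weight c e)
           = (1 - \<alpha>) / (1 + \<alpha>) * (\<alpha> powi (1 - int n) - \<alpha> powi (int n - 1))
         \<and> real (card (spanning_trees (zigzag_ladder_between 0 (int n - 1))))
           = 1 / sqrt 5 * (((3 + sqrt 5) / 2) ^ (n - 1) - ((3 - sqrt 5) / 2) ^ (n - 1))"
proof -
  define N where "N = n - 1"
  have N: "1 \<le> N" "int n - 1 = int N" "1 - int n = - int N" using assms(3) by (auto simp: N_def)
  have 1: "tree_sum (zigzag_weight c) (ladder N)
      = (1 - \<alpha>) / (1 + \<alpha>) * (\<alpha> powi (- int N) - \<alpha> powi int N)"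
    using tree_sum_ladder_closed_form[OF decay_rate_eq[OF assms(1,2)] N(1)]
    by (simp add: power_int_minus power_one_over inverse_eq_divide)
  \<comment> \<open>The value of \<open>\<alpha>\<close> at \<open>c = 1\<close>; the count does not depend on the given \<open>c\<close>.\<close>
  define \<gamma> :: real where "\<gamma> = (3 - sqrt 5) / 2"
  have s5: "sqrt 5 * sqrt 5 = (5::real)" by simp
  have "\<gamma> = 1 + 1 / 2 - sqrt (4 * 1 + 1\<^sup>2) / 2" by (simp add: \<gamma>_def field_simps)
  note \<gamma> = decay_rate_eq[OF zero_less_one this]
  have inv: "1 / \<gamma> = (3 + sqrt 5) / 2" using \<gamma>(2) by (simp add: \<gamma>_def field_simps)
  have "sqrt 5 * (1 - \<gamma>) = 1 + \<gamma>" using s5 by (simp add: \<gamma>_def field_simps)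
  then have "(1 - \<gamma>) / (1 + \<gamma>) = 1 / sqrt 5" using \<gamma>(1) by (simp add: field_simps)
  then have "real (card (spanning_trees (ladder N)))
      = 1 / sqrt 5 * (((3 + sqrt 5) / 2) ^ N - ((3 - sqrt 5) / 2) ^ N)"
    using tree_sum_ladder_closed_form[OF \<gamma> N(1)]
    unfolding card_spanning_trees_eq_tree_sum inv by (simp add: \<gamma>_def)
  with 1 show ?thesis unfolding N(2,3) by (simp add: tree_sum_def ladder_def N_def)
qed

end
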